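(* Let $k\mathrm{AND}=f_{\{k\},k}:\{-1,1\}^k\to\{0,1\}$ be the function which is $1$ exactly on the all-ones vector, and let $\rho(k\mathrm{AND})=\Pr_{\mathbf b\sim\mathrm{Unif}(\{-1,1\}^k)}[k\mathrm{AND}(\mathbf b)=1]=2^{-k}$. Then $\lim_{k\to\infty}\frac{\alpha(k\mathrm{AND})}{2\rho(k\mathrm{AND})}=1$.
   Context: For $\mathbf b\in\{-1,1\}^k$, $\mathrm{wt}(\mathbf b)$ is the number of coordinates equal to $1$. For nonempty $S\subseteq[k]=\{1,\dots,k\}$, $f_{S,k}:\{-1,1\}^k\to\{0,1\}$ is given by $f_{S,k}(\mathbf x)=1$ iff $\mathrm{wt}(\mathbf x)\in S$. $\Delta_k$ is the set of symmetric probability distributions $\mathcal D$ on $\{-1,1\}^k$ (vectors of equal weight are equiprobable). $\mathrm{Bern}(p)$ is the random variable equal to $1$ with probability $p$ and $-1$ with probability $1-p$; $\odot$ is the coordinatewise product. For $\mathcal D\in\Delta_k$ and $p\in[0,1]$ define $$\lambda_S(\mathcal D,p)=\mathbb E_{\mathbf a\sim\mathcal D,\ \mathbf b\sim \mathrm{Bern}(p)^k}[f_{S,k}(\mathbf a\odot\mathbf b)],\quad \mu(\mathcal D)=\mathbb E_{\mathbf b\sim\mathcal D}[b_1],\quad \beta_S(\mathcal D)=\sup_{p\in[0,1]}\lambda_S(\mathcal D,p),\quad \gamma_S(\mathcal D)=\lambda_S(\mathcal D,1).$$ The (sketching approximation) ratio of $f_{S,k}$ is $$\alpha(f_{S,k})=\inf_{\mathcal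 D_N,\mathcal D_Y\in\Delta_k:\ \mu(\mathcal D_N)=\mu(\mathcal D_Y)}\frac{\beta_S(\mathcal D_N)}{\gamma_S(\mathcal D_Y)},$$ where the ratio is $+\infty$ if $\gamma_S(\mathcal D_Y)=0$. *)

theory Defs
  imports "HOL-Probability.Probability"
begin

text \<open>The cube of sign vectors with coordinates indexed by 1, ..., k. Vectors are extensional
  functions, so that each element of the cube has exactly one representation.\<close>

definition cube :: "nat \<Rightarrow> (nat \<Rightarrow> int) set" where
  "cube k = {1..k} \<rightarrow>\<^sub>E {-1, 1}"

definition wt :: "nat \<Rightarrow> (nat \<Rightarrow> int) \<Rightarrow> nat" where
  "wt k b = card {i \<in> {1..k}. b i = 1}"

definition fS :: "nat set \<Rightarrow> nat \<Rightarrow> (nat \<Rightarrow> int) \<Rightarrow> real" where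
  "fS S k x = (if wt k x \<in> S then 1 else 0)"

definition sym_dists :: "nat \<Rightarrow> (nat \<Rightarrow> int) pmf set" where
  "sym_dists k = {D. set_pmf D \<subseteq> cube k \<and>
     (\<forall>x\<in>cube k. \<forall>y\<in>cube k. wt k x = wt k y \<longrightarrow> pmf D x = pmf D y)}"

definition bern :: "real \<Rightarrow> int pmf" where
  "bern p = map_pmf (\<lambda>b. if b then 1 else -1) (bernoulli_pmf p)"

text \<open>The default value \<open>undefined\<close> outside the index set is the one used by extensional
  functions, so this distribution lives on the cube.\<close>

definition bern_vec :: "nat \<Rightarrow> real \<Rightarrow> (nat \<Rightarrow> int) pmf" where
  "bern_vec k p = Pi_pmf {1..k} undefined (\<lambda>_. bern p)"

definition cprod :: "nat \<Rightarrow> (nat \<Rightarrow> int) \<Rightarrow> (nat \<Rightarrow> int) \<Rightarrow> (nat \<Rightarrow> int)" where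
  "cprod k a b = (\<lambda>i\<in>{1..k}. a i * b i)"

definition lambda_S :: "nat set \<Rightarrow> nat \<Rightarrow> (nat \<Rightarrow> int) pmf \<Rightarrow> real \<Rightarrow> real" where
  "lambda_S S k D p =
     measure_pmf.expectation (pair_pmf D (bern_vec k p)) (\<lambda>(a, b). fS S k (cprod k a b))"

definition mu :: "(nat \<Rightarrow> int) pmf \<Rightarrow> real" where
  "mu D = measure_pmf.expectation D (\<lambda>b. real_of_int (b 1))"

definition beta_S :: "nat set \<Rightarrow> nat \<Rightarrow> (nat \<Rightarrow> int) pmf \<Rightarrow> real" where
  "beta_S S k D = (SUP p\<in>{0..1}. lambda_S S k D p)"

definition gamma_S :: "nat set \<Rightarrow> nat \<Rightarrow> (nat \<Rightarrow> int) pmf \<Rightarrow> real" where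
  "gamma_S S k D = lambda_S S k D 1"

text \<open>The ratio \<open>\<alpha>(f\<^sub>S\<^sub>,\<^sub>k)\<close>, an infimum in the extended reals. The case \<open>\<gamma> = 0\<close> is
  explicit because \<open>0 / 0 = 0\<close> in the type \<open>ereal\<close>.\<close>

definition alpha :: "nat set \<Rightarrow> nat \<Rightarrow> ereal" where
  "alpha S k =
     (INF (DN, DY) \<in> {(DN, DY). DN \<in> sym_dists k \<and> DY \<in> sym_dists k \<and> mu DN = mu DY}.
        if gamma_S S k DY = 0 then \<infinity> else ereal (beta_S S k DN / gamma_S S k DY))"

definition rho :: "nat \<Rightarrow> ((nat \<Rightarrow> int) \<Rightarrow> real) \<Rightarrow> real" where
  "rho k f = measure_pmf.prob (pmf_of_set (cube k)) {b. f b = 1}"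

abbreviation kAND :: "nat \<Rightarrow> (nat \<Rightarrow> int) \<Rightarrow> real" where
  "kAND k \<equiv> fS {k} k"

lemma kAND_eq_1_iff: "kAND k x = 1 \<longleftrightarrow> (\<forall>i\<in>{1..k}. x i = 1)"
proof -
  have "{i \<in> {1..k}. x i = 1} \<subseteq> {1..k}" by blast
  then have "card {i \<in> {1..k}. x i = 1} = k \<longleftrightarrow> {i \<in> {1..k}. x i = 1} = {1..k}"
    by (metis card_subset_eq card_atLeastAtMost diff_Suc_1 finite_atLeastAtMost One_nat_def)
  also have "\<dots> \<longleftrightarrow> (\<forall>i\<in>{1..k}. x i = 1)" by blast
  finally show ?thesis by (simp add: fS_def wt_def)
qed

lemma rho_kAND: "rho k (kAND k) = 1 / 2 ^ k"
proof -
  have fin: "finite (cube k)" and ne: "cube k \<noteq> {}"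
    by (auto simp: cube_def PiE_eq_empty_iff intro!: finite_PiE)
  have "cube k \<inter> {b. kAND k b = 1} = {\<lambda>i\<in>{1..k}. 1}"
    unfolding kAND_eq_1_iff
    by (auto simp: cube_def PiE_iff extensional_def fun_eq_iff restrict_def)
  moreover have "card (cube k) = 2 ^ k"
    by (simp add: cube_def card_PiE numeral_2_eq_2)
  ultimately show ?thesis
    using fin ne by (simp add: rho_def measure_pmf_of_set)
qed

end

theory Submission
  imports Defs "HOL-Real_Asymp.Real_Asymp"
begin

text \<open>For a symmetric distribution on the cube let \<open>m\<close> be the probability that the first coordinate
  is \<open>1\<close>, so that \<open>\<mu> = 2m - 1\<close> and the expected weight is \<open>km\<close>. Then \<open>\<gamma> \<le> m\<close>. On the other hand
  \<open>\<lambda>(p)\<close> is the expectation of \<open>p^i (1 - p)^(k - i)\<close> where \<open>i\<close> is the weight. For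
  \<open>p = exp (1/k) / (2 cosh (1/k))\<close> this function of \<open>i\<close> is \<open>exp (2i/k - 1) / (2 cosh (1/k))^k\<close>,
  and \<open>exp x \<ge> 1 + x\<close> bounds it below by \<open>(2i/k) / (2 cosh (1/k))^k\<close>.
  Hence \<open>\<beta> \<ge> 2m / (2 cosh (1/k))^k\<close> and \<open>\<alpha> \<ge> 2 / (2 cosh (1/k))^k\<close>. Conversely, the uniform
  distribution, paired with the uniform distribution on the two constant vectors, shows
  \<open>\<alpha> \<le> 2 / 2^k\<close>. The quotient of these bounds, \<open>cosh (1/k)^k\<close>, tends to \<open>1\<close>.\<close>

section \<open>Sign vectors and the extreme weights\<close>

lemma finite_cube [simp]: "finite (cube k)"
  by (auto simp: cube_def intro!: finite_PiE)

lemma cubeD: "a \<in> cube k \<Longrightarrow> i \<in> {1..k} \<Longrightarrow> a i = 1 \<or> a i = -1"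
  by (auto simp: cube_def)

lemma cube_eqI: "a \<in> cube k \<Longrightarrow> b \<in> cube k \<Longrightarrow> (\<And>i. i \<in> {1..k} \<Longrightarrow> a i = b i) \<Longrightarrow> a = b"
  unfolding cube_def by (rule PiE_ext)

definition const_vec :: "nat \<Rightarrow> int \<Rightarrow> nat \<Rightarrow> int" where
  "const_vec k c = (\<lambda>i\<in>{1..k}. c)"

lemma const_vec_in_cube [simp]: "const_vec k 1 \<in> cube k" "const_vec k (-1) \<in> cube k"
  by (auto simp: const_vec_def cube_def)

lemma wt_le: "wt k a \<le> k"
proof -
  have "wt k a \<le> card {1..k}"
    unfolding wt_def by (intro card_mono) auto
  thus ?thesis by simp
qed

lemma wt_eq_k_iff: "a \<in> cube k \<Longrightarrow> wt k a = k \<longleftrightarrow> a = const_vec k 1"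
proof -
  assume a: "a \<in> cube k"
  have "wt k a = k \<longleftrightarrow> (\<forall>i\<in>{1..k}. a i = 1)"
    using kAND_eq_1_iff[of k a] by (simp add: fS_def split: if_splits)
  also have "\<dots> \<longleftrightarrow> a = const_vec k 1"
    using cube_eqI[OF a const_vec_in_cube(1)] by (auto simp: const_vec_def)
  finally show ?thesis .
qed

lemma wt_eq_0_iff: "a \<in> cube k \<Longrightarrow> wt k a = 0 \<longleftrightarrow> a = const_vec k (-1)"
proof -
  assume a: "a \<in> cube k"
  have "wt k a = 0 \<longleftrightarrow> (\<forall>i\<in>{1..k}. a i \<noteq> 1)"
    by (auto simp: wt_def)
  also have "\<dots> \<longleftrightarrow> (\<forall>i\<in>{1..k}. a i = -1)"
    using cubeD[OF a] by force
  also have "\<dots> \<longleftrightarrow> a = const_vec k (-1)"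
    using cube_eqI[OF a const_vec_in_cube(2)] by (auto simp: const_vec_def)
  finally show ?thesis .
qed

section \<open>Point masses of \<open>bern_vec\<close>, and \<open>lambda_S\<close> as a coincidence
  probability\<close>

lemma pmf_bern_vec:
  assumes "a \<in> cube k" "p \<in> {0..1}"
  shows "pmf (bern_vec k p) a = p ^ wt k a * (1 - p) ^ (k - wt k a)"
proof -
  have pb: "pmf (bern p) (a i) = (if a i = 1 then p else 1 - p)" if "i \<in> {1..k}" for i
  proof -
    have inj: "inj (\<lambda>b. if b then 1 else -1 :: int)"
      by (auto simp: inj_def)
    have "pmf (bern p) 1 = p" "pmf (bern p) (-1) = 1 - p"
      using pmf_map_inj'[OF inj, of "bernoulli_pmf p" True]
        pmf_map_inj'[OF inj, of "bernoulli_pmf p" False] assms(2)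
      by (auto simp: bern_def)
    thus ?thesis using cubeD[OF assms(1) that] by auto
  qed
  have "pmf (bern_vec k p) a = (\<Prod>i\<in>{1..k}. pmf (bern p) (a i))"
    unfolding bern_vec_def using assms(1) by (intro pmf_Pi') (auto simp: cube_def)
  also have "\<dots> = (\<Prod>i\<in>{1..k}. if a i = 1 then p else 1 - p)"
    by (intro prod.cong refl pb)
  also have "\<dots> = p ^ card {i\<in>{1..k}. a i = 1} * (1 - p) ^ card {i\<in>{1..k}. a i \<noteq> 1}"
    by (subst prod.If_cases) (simp_all add: Int_def)
  also have "card {i\<in>{1..k}. a i \<noteq> 1} = k - wt k a"
  proof -
    have "{i\<in>{1..k}. a i \<noteq> 1} = {1..k} - {i\<in>{1..k}. a i = 1}" by auto
    moreover have "card ({1..k} - {i\<in>{1..k}. a i = 1}) = card {1..k} - wt k a"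
      unfolding wt_def by (intro card_Diff_subset) auto
    ultimately show ?thesis by simp
  qed
  finally show ?thesis by (simp add: wt_def)
qed

lemma set_bern_vec: "set_pmf (bern_vec k p) \<subseteq> cube k"
proof -
  have "set_pmf (bern p) \<subseteq> {-1, 1}"
    by (auto simp: bern_def)
  hence "PiE_dflt {1..k} undefined (\<lambda>_. set_pmf (bern p)) \<subseteq> cube k"
    unfolding PiE_dflt_def cube_def by (fastforce intro!: PiE_I)
  thus ?thesis
    by (simp add: bern_vec_def set_Pi_pmf comp_def)
qed

text \<open>Two signs multiply to 1 exactly when they agree. This makes \<open>lambda_S\<close> the
  probability that two independent draws coincide.\<close>

lemma kAND_cprod:
  assumes "a \<in> cube k" "b \<in> cube k"
  shows "kAND k (cprod k a b) = (if a = b then 1 else 0)"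
proof -
  have "kAND k (cprod k a b) = 1 \<longleftrightarrow> (\<forall>i\<in>{1..k}. a i * b i = 1)"
    unfolding kAND_eq_1_iff by (simp add: cprod_def)
  also have "\<dots> \<longleftrightarrow> (\<forall>i\<in>{1..k}. a i = b i)"
    using cubeD[OF assms(1)] cubeD[OF assms(2)] by (intro ball_cong refl) force
  also have "\<dots> \<longleftrightarrow> a = b"
    using cube_eqI[OF assms] by auto
  finally show ?thesis by (auto simp: fS_def split: if_splits)
qed

lemma lambda_kAND:
  assumes D: "set_pmf D \<subseteq> cube k"
  shows "lambda_S {k} k D p = (\<Sum>a\<in>cube k. pmf D a * pmf (bern_vec k p) a)"
proof -
  have "lambda_S {k} k D p = (\<Sum>(a, b)\<in>cube k \<times> cube k.
      kAND k (cprod k a b) * (pmf D a * pmf (bern_vec k p) b))"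
    unfolding lambda_S_def using D set_bern_vec[of k p]
    by (subst integral_measure_pmf_real[where A = "cube k \<times> cube k"])
      (auto simp: pmf_pair intro!: sum.cong)
  also have "\<dots> = (\<Sum>a\<in>cube k. \<Sum>b\<in>cube k.
      if a = b then pmf D a * pmf (bern_vec k p) b else 0)"
    by (subst sum.cartesian_product [symmetric]) (intro sum.cong refl, simp add: kAND_cprod)
  finally show ?thesis by simp
qed

lemma gamma_kAND:
  assumes D: "set_pmf D \<subseteq> cube k"
  shows "gamma_S {k} k D = pmf D (const_vec k 1)"
proof -
  have "pmf (bern_vec k 1) a = (if a = const_vec k 1 then 1 else 0)" if "a \<in> cube k" for a
    \<comment> \<open>At \<open>p = 1\<close> the second factor is a power of 0, and
      \<open>0 ^ 0 = 1\<close> singles out weight \<open>k\<close>; \<open>wt_le\<close> rules out a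
      truncated difference \<open>k - wt k a\<close>.\<close>
    using wt_eq_k_iff[OF that] wt_le[of k a] by (auto simp: pmf_bern_vec[OF that] power_0_left)
  hence "gamma_S {k} k D = (\<Sum>a\<in>cube k. pmf D a * (if a = const_vec k 1 then 1 else 0))"
    unfolding gamma_S_def lambda_kAND[OF D] by (intro sum.cong) auto
  also have "\<dots> = (\<Sum>a\<in>cube k. if a = const_vec k 1 then pmf D a else 0)"
    by (intro sum.cong) auto
  finally show ?thesis by simp
qed

text \<open>Supplies the upper bound without which the real supremum in \<open>beta_S\<close> would
  say nothing.\<close>

lemma lambda_kAND_le_1: "set_pmf D \<subseteq> cube k \<Longrightarrow> lambda_S {k} k D p \<le> 1"
proof -
  assume D: "set_pmf D \<subseteq> cube k"
  have "lambda_S {k} k D p \<le> (\<Sum>a\<in>cube k. pmf D a * 1)"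
    unfolding lambda_kAND[OF D] by (intro sum_mono mult_left_mono) (auto simp: pmf_le_1)
  thus ?thesis using sum_pmf_eq_1[OF finite_cube D] by simp
qed

lemma lambda_le_beta:
  assumes "set_pmf D \<subseteq> cube k" "p \<in> {0..1}"
  shows "lambda_S {k} k D p \<le> beta_S {k} k D"
  unfolding beta_S_def using lambda_kAND_le_1[OF assms(1)]
  by (intro cSUP_upper assms(2) bdd_aboveI2[where M = 1])

section \<open>Mean and expected weight of a symmetric distribution\<close>

lemma mu_eq_prob:
  assumes D: "set_pmf D \<subseteq> cube k" and k: "k \<ge> 1"
  shows "mu D = 2 * measure_pmf.prob D {a. a 1 = 1} - 1"
proof -
  have "mu D = measure_pmf.expectation D (\<lambda>b. 2 * indicator {a. a 1 = 1} b - 1)"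
    unfolding mu_def using cubeD[of _ k 1] D k
    by (intro integral_cong_AE) (fastforce simp: AE_measure_pmf_iff indicator_def)+
  also have "\<dots> = 2 * measure_pmf.prob D {a. a 1 = 1} - 1"
    by (subst Bochner_Integration.integral_diff) 
      (auto intro!: measure_pmf.integrable_const_bound[where B = 1])
  finally show ?thesis .
qed

text \<open>Swapping coordinates \<open>i\<close> and \<open>j\<close> preserves the weight, hence
  by symmetry the point masses, and exchanges the two events.\<close>

lemma prob_coord_eq:
  assumes D: "D \<in> sym_dists k" and i: "i \<in> {1..k}" and j: "j \<in> {1..k}"
  shows "measure_pmf.prob D {a. a i = 1} = measure_pmf.prob D {a. a j = 1}"
proof -
  define \<tau> where "\<tau> = (\<lambda>a::nat \<Rightarrow> int. a \<circ> Transposition.transpose i j)"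
  have tt: "\<tau> (\<tau> a) = a" for a
    by (simp add: \<tau>_def comp_assoc)
  have perm: "Transposition.transpose i j permutes {1..k}"
    using i j by (rule permutes_swap_id)
  note range = permutes_in_image[OF perm]
  have cube: "\<tau> a \<in> cube k" if "a \<in> cube k" for a
    using that unfolding cube_def \<tau>_def
    by (auto simp: PiE_iff extensional_def range simp del: atLeastAtMost_iff One_nat_def)
  have wt: "wt k (\<tau> a) = wt k a" for a
  proof -
    have "bij_betw (Transposition.transpose i j) {l \<in> {1..k}. \<tau> a l = 1} {l \<in> {1..k}. a l = 1}"
      by (intro bij_betw_byWitness[where f' = "Transposition.transpose i j"])
        (auto simp: \<tau>_def range simp del: atLeastAtMost_iff One_nat_def)
    thus ?thesis unfolding wt_def by (rule bij_betw_same_card)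
  qed
  have supp: "set_pmf D \<subseteq> cube k" using D by (simp add: sym_dists_def)
  have prob: "measure_pmf.prob D {a. a l = 1} = (\<Sum>a\<in>{a\<in>cube k. a l = 1}. pmf D a)" for l
  proof -
    \<comment> \<open>Intersecting with the cube makes the event finite, so its probability is a
      finite sum.\<close>
    have "measure_pmf.prob D {a. a l = 1} = measure_pmf.prob D {a\<in>cube k. a l = 1}"
      using supp by (intro measure_eq_AE) (auto simp: AE_measure_pmf_iff)
    thus ?thesis by (simp add: measure_measure_pmf_finite)
  qed
  have "(\<Sum>a\<in>{a\<in>cube k. a i = 1}. pmf D a) = (\<Sum>a\<in>{a\<in>cube k. a j = 1}. pmf D a)"
  \<comment> \<open>\<open>\<tau>\<close> is an involution, so it serves as its own inverse.\<close>
  proof (rule sum.reindex_bij_witness[where i = \<tau> and j = \<tau>])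
    show "pmf D (\<tau> a) = pmf D a" if "a \<in> {a\<in>cube k. a i = 1}" for a
      using that D cube[of a] wt[of a] unfolding sym_dists_def by blast
  qed (auto simp: tt cube, auto simp: \<tau>_def)
  thus ?thesis by (simp add: prob)
qed

text \<open>Linearity of expectation: the weight is a sum of \<open>k\<close> coordinate indicators,
  each of probability \<open>(1 + mu D) / 2\<close>.\<close>

lemma expected_wt:
  assumes D: "D \<in> sym_dists k" and k: "k \<ge> 1"
  shows "(\<Sum>a\<in>cube k. pmf D a * real (wt k a)) = real k * (1 + mu D) / 2" (is "?lhs = ?rhs")
proof -
  have supp: "set_pmf D \<subseteq> cube k" using D by (simp add: sym_dists_def)
  have "?lhs = measure_pmf.expectation D (\<lambda>a. real (wt k a))"
    using supp by (subst integral_measure_pmf_real[where A = "cube k"]) (auto simp: mult.commute)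
  also have "\<dots> = measure_pmf.expectation D (\<lambda>a. \<Sum>i\<in>{1..k}. indicator {a. a i = 1} a)"
    by (simp add: wt_def indicator_def sum.If_cases Int_def)
  also have "\<dots> = (\<Sum>i\<in>{1..k}. measure_pmf.prob D {a. a i = 1})"
    by (subst Bochner_Integration.integral_sum)
      (auto intro!: measure_pmf.integrable_const_bound[where B = 1])
  also have "\<dots> = (\<Sum>i\<in>{1..k}. measure_pmf.prob D {a. a 1 = 1})"
    using k by (intro sum.cong refl prob_coord_eq[OF D]) auto
  also have "\<dots> = ?rhs"
    using mu_eq_prob[OF supp k] by simp
  finally show ?thesis .
qed

section \<open>Lower bound on the ratio\<close>

lemma gamma_le:
  assumes D: "set_pmf D \<subseteq> cube k" and k: "k \<ge> 1"
  shows "gamma_S {k} k D \<le> (1 + mu D) / 2"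
proof -
  \<comment> \<open>The all-ones vector lies in the event on the right, since
    \<open>k \<ge> 1\<close>.\<close>
  have "pmf D (const_vec k 1) \<le> measure_pmf.prob D {a. a 1 = 1}"
    unfolding measure_pmf_single [symmetric] using k
    by (intro measure_pmf.finite_measure_mono) (auto simp: const_vec_def)
  thus ?thesis by (simp add: gamma_kAND[OF D] mu_eq_prob[OF D k])
qed

lemma beta_ge:
  assumes D: "D \<in> sym_dists k" and k: "k \<ge> 1"
  shows "beta_S {k} k D \<ge> (1 + mu D) / (2 * cosh (1 / real k)) ^ k"
proof -
  define x where "x = 1 / real k"
  define C where "C = 2 * cosh x"
  \<comment> \<open>\<open>p\<close> and \<open>1 - p\<close> are proportional to
    \<open>exp x\<close> and \<open>exp (-x)\<close>, with \<open>C\<close> the normalising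
    constant. With \<open>x = 1 / k\<close> the tangent at weight \<open>k / 2\<close> passes
    through the origin, so the lower bound is a pure multiple of the weight.\<close>
  define p where "p = exp x / C"
  have supp: "set_pmf D \<subseteq> cube k" using D by (simp add: sym_dists_def)
  have C: "C = exp x + exp (-x)" "C > 0"
    by (simp_all add: C_def cosh_def add_pos_pos)
  have q: "1 - p = exp (-x) / C"
    using C by (simp add: p_def field_simps)
  have p: "p \<in> {0..1}"
    using C by (simp add: p_def)
  have tangent: "2 * real i / real k / C ^ k \<le> p ^ i * (1 - p) ^ (k - i)" if "i \<le> k" for i
  proof -
    have "p ^ i * (1 - p) ^ (k - i) = (exp x ^ i * exp (-x) ^ (k - i)) / (C ^ i * C ^ (k - i))"
      by (simp only: q) (simp add: p_def power_divide)
    also have "C ^ i * C ^ (k - i) = C ^ k"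
      using that by (simp flip: power_add)
    also have "exp x ^ i * exp (-x) ^ (k - i) = exp (real i * x + real (k - i) * (-x))"
      unfolding exp_of_nat_mult [symmetric] exp_add ..
    also have "real i * x + real (k - i) * (-x) = 2 * real i / real k - 1"
      using that k by (simp add: x_def of_nat_diff field_simps)
    finally have eq: "p ^ i * (1 - p) ^ (k - i) = exp (2 * real i / real k - 1) / C ^ k" .
    have "2 * real i / real k \<le> exp (2 * real i / real k - 1)"
      using exp_ge_add_one_self[of "2 * real i / real k - 1"] by simp
    thus ?thesis
      unfolding eq using C(2) by (intro divide_right_mono zero_le_power order_less_imp_le[of 0 C])
  qed
  \<comment> \<open>The last factor is the expected weight, so the pointwise bound
    \<open>tangent\<close> can be averaged over \<open>D\<close>.\<close>
  have "(1 + mu D) / C ^ k = 2 / real k / C ^ k * (real k * (1 + mu D) / 2)"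
    using k by (simp del: distrib_left_numeral distrib_right_numeral)
  also have "\<dots> = (\<Sum>a\<in>cube k. pmf D a * (2 * real (wt k a) / real k / C ^ k))"
    unfolding expected_wt[OF D k, symmetric] sum_distrib_left
    by (intro sum.cong refl) simp
  also have "\<dots> \<le> (\<Sum>a\<in>cube k. pmf D a * pmf (bern_vec k p) a)"
  proof (intro sum_mono mult_left_mono)
    show "2 * real (wt k a) / real k / C ^ k \<le> pmf (bern_vec k p) a" if "a \<in> cube k" for a
      unfolding pmf_bern_vec[OF that p] by (rule tangent[OF wt_le])
  qed simp
  also have "\<dots> \<le> beta_S {k} k D"
    unfolding lambda_kAND[OF supp, symmetric] by (rule lambda_le_beta[OF supp p])
  finally show ?thesis by (simp add: C_def x_def)
qed

text \<open>The bounds on \<open>beta_S\<close> and \<open>gamma_S\<close> are both multiples of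
  \<open>1 + mu\<close>, which is the same for \<open>DN\<close> and \<open>DY\<close>.\<close>

lemma alpha_kAND_ge:
  assumes k: "k \<ge> 1"
  shows "alpha {k} k \<ge> ereal (2 / (2 * cosh (1 / real k)) ^ k)"
  unfolding alpha_def
proof (rule INF_greatest, clarify)
  fix DN DY
  assume DN: "DN \<in> sym_dists k" and DY: "DY \<in> sym_dists k" and eq: "mu DN = mu DY"
  have supp: "set_pmf DY \<subseteq> cube k" using DY by (simp add: sym_dists_def)
  have nonneg: "gamma_S {k} k DY \<ge> 0"
    by (simp add: gamma_kAND[OF supp])
  have "2 / (2 * cosh (1 / real k)) ^ k * gamma_S {k} k DY
      \<le> 2 / (2 * cosh (1 / real k)) ^ k * ((1 + mu DY) / 2)"
    by (intro mult_left_mono gamma_le[OF supp k]) simp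
  also have "\<dots> \<le> beta_S {k} k DN"
    using beta_ge[OF DN k] eq by (simp add: field_simps)
  finally have "2 / (2 * cosh (1 / real k)) ^ k \<le> beta_S {k} k DN / gamma_S {k} k DY"
    if "gamma_S {k} k DY \<noteq> 0"
    using nonneg that by (subst pos_le_divide_eq) auto
  thus "ereal (2 / (2 * cosh (1 / real k)) ^ k)
      \<le> (if gamma_S {k} k DY = 0 then \<infinity> else ereal (beta_S {k} k DN / gamma_S {k} k DY))"
    by (simp only: ereal_less_eq split: if_split) simp
qed

section \<open>Upper bound on the ratio\<close>

lemma alpha_kAND_le:
  assumes k: "k \<ge> 1"
  shows "alpha {k} k \<le> ereal (2 / 2 ^ k)"
proof -
  \<comment> \<open>This is the uniform distribution on the cube; in product form its marginals are
    immediate.\<close>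
  define DN where "DN = bern_vec k (1 / 2)"
  \<comment> \<open>This choice has mean 0 and attains equality in \<open>gamma_le\<close>.\<close>
  define DY where "DY = pmf_of_set {const_vec k 1, const_vec k (-1)}"
  \<comment> \<open>For \<open>k = 0\<close> the two vectors would coincide.\<close>
  have ne: "const_vec k 1 \<noteq> const_vec k (-1)"
    using k by (auto simp: const_vec_def fun_eq_iff)
  have suppN: "set_pmf DN \<subseteq> cube k" and suppY: "set_pmf DY \<subseteq> cube k"
    using set_bern_vec by (auto simp: DN_def DY_def)
  have pmfN: "pmf DN a = 1 / 2 ^ k" if "a \<in> cube k" for a
    using that wt_le[of k a] by (simp add: DN_def pmf_bern_vec power_divide flip: power_add)
  have N: "DN \<in> sym_dists k"
    using suppN pmfN by (simp add: sym_dists_def)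
  \<comment> \<open>Written through the weight alone, the point masses are visibly
    symmetric.\<close>
  have pmfY: "pmf DY a = (if wt k a = k \<or> wt k a = 0 then 1 / 2 else 0)" if "a \<in> cube k" for a
    using ne by (simp add: DY_def wt_eq_k_iff[OF that] wt_eq_0_iff[OF that])
  have Y: "DY \<in> sym_dists k"
    using suppY pmfY by (simp add: sym_dists_def)
  have muN: "mu DN = 0"
  proof -
    have "mu DN = measure_pmf.expectation (map_pmf (\<lambda>b. b 1) DN) real_of_int"
      by (simp add: mu_def)
    also have "map_pmf (\<lambda>b. b 1) DN = bern (1 / 2)"
      unfolding DN_def bern_vec_def using k by (subst Pi_pmf_component) auto
    also have "measure_pmf.expectation \<dots> real_of_int = 0"
      by (simp add: bern_def)
    finally show ?thesis .
  qed
  have muY: "mu DY = 0"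
    unfolding mu_def DY_def using ne k by (subst integral_pmf_of_set) (auto simp: const_vec_def)
  have gammaY: "gamma_S {k} k DY = 1 / 2"
    using ne unfolding gamma_kAND[OF suppY] by (simp add: DY_def)
  \<comment> \<open>A uniform draw hits any independent vector of the cube with probability
    \<open>1 / 2 ^ k\<close>, so the supremum is over a constant.\<close>
  have "lambda_S {k} k DN p = 1 / 2 ^ k" for p
  proof -
    have "lambda_S {k} k DN p = 1 / 2 ^ k * (\<Sum>a\<in>cube k. pmf (bern_vec k p) a)"
      unfolding lambda_kAND[OF suppN] sum_distrib_left by (intro sum.cong refl) (simp add: pmfN)
    thus ?thesis using sum_pmf_eq_1[OF finite_cube set_bern_vec, of k p] by simp
  qed
  hence betaN: "beta_S {k} k DN = 1 / 2 ^ k"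
    by (simp add: beta_S_def)
  have "alpha {k} k \<le> (case (DN, DY) of (DN, DY) \<Rightarrow>
      if gamma_S {k} k DY = 0 then \<infinity> else ereal (beta_S {k} k DN / gamma_S {k} k DY))"
    unfolding alpha_def using N Y muN muY by (intro INF_lower) simp
  thus ?thesis by (simp add: gammaY betaN)
qed

section \<open>The limit\<close>

theorem corollary1p3:
  shows "(\<lambda>k::nat. alpha {k} k / ereal (2 * rho k (kAND k))) \<longlonglongrightarrow> 1"
proof (rule tendsto_sandwich)
  have pos: "ereal (2 * rho k (kAND k)) > 0" for k
    by (simp add: rho_kAND)
  show "\<forall>\<^sub>F k in sequentially.
      ereal (1 / cosh (1 / real k) ^ k) \<le> alpha {k} k / ereal (2 * rho k (kAND k))"
    using eventually_ge_at_top[of 1]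
  proof eventually_elim
    case (elim k)
    have "ereal (2 / (2 * cosh (1 / real k)) ^ k) / ereal (2 * rho k (kAND k))
        \<le> alpha {k} k / ereal (2 * rho k (kAND k))"
      by (intro ereal_divide_right_mono alpha_kAND_ge elim pos)
    thus ?case by (simp add: rho_kAND power_mult_distrib)
  qed
  show "\<forall>\<^sub>F k in sequentially. alpha {k} k / ereal (2 * rho k (kAND k)) \<le> 1"
    using eventually_ge_at_top[of 1]
  proof eventually_elim
    case (elim k)
    have "alpha {k} k / ereal (2 * rho k (kAND k))
        \<le> ereal (2 / 2 ^ k) / ereal (2 * rho k (kAND k))"
      by (intro ereal_divide_right_mono alpha_kAND_le elim pos)
    thus ?case by (simp add: rho_kAND)
  qed
  \<comment> \<open>\<open>cosh\<close> is spelled out through \<open>exp\<close>. The limit holds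
    because \<open>k * ln (cosh (1 / k))\<close> behaves like \<open>1 / (2 * k)\<close>.\<close>
  have "(\<lambda>k. 1 / ((exp (1 / real k) + exp (- (1 / real k))) / 2) ^ k) \<longlonglongrightarrow> 1"
    by real_asymp
  thus "(\<lambda>k. ereal (1 / cosh (1 / real k) ^ k)) \<longlonglongrightarrow> 1"
    unfolding one_ereal_def cosh_field_def by (rule tendsto_ereal)
qed simp

end
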